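(* Let $n\in\mathbb N$. For every $0\le k\le n$, the sequence $(d_{n,k,j}(x))_{0\le j\le n}$ is an interlacing sequence of real-rooted polynomials. Moreover, $d_{n,k,j}(x)$ is interlaced by the Eulerian polynomial $A_n(x)$ for every $j\in\{0,1,\dots,n-k\}$.
   Context: For $w\in\mathfrak S_m$, $\mathrm{exc}(w)=\#\{i:w(i)>i\}$, $\mathrm{Fix}(w)$ is the set of fixed points, and $\mathcal D_{m,k}$ is the set of $w\in\mathfrak S_m$ with $\mathrm{Fix}(w)\subseteq[m-k]$. Define $d_{0,0,0}(x)=1$ and, for $n\ge1$ and $k,j\in\{0,\dots,n\}$, $d_{n,k,j}(x)=\sum_{w\in\mathcal D_{n+1,k}:\,w^{-1}(1)=j+1}x^{\mathrm{exc}(w)}$. $A_n(x)=\sum_{w\in\mathfrak S_n}x^{\mathrm{des}(w)}$ with $\mathrm{des}(w)=\#\{i\in[n-1]:w(i)>w(i+1)\}$, $A_0=1$. Real-rooted: all roots real or the zero polynomial. For real-rooted $f$ (roots $\alpha_1\ge\alpha_2\ge\cdots$) and $g$ (roots $\beta_1\ge\beta_2\ge\cdots$), $f\preceq g$ ("$f$ interlaces $g$") means $\cdots\le\alpha_2\le\beta_2\le\alpha_1\le\beta_1$; the zero polynomial interlaces and is interlaced by every real-rooted polynomial, and nonzero constants interlace every polynomial of degree at most one. A sequence $(f_0,\dots,f_m)$ is interlacing if $f_i\preceq f_j$ for all $i<j$. *)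

theory Defs
  imports
    "HOL-Analysis.Analysis"
    "HOL-Computational_Algebra.Computational_Algebra"
    "HOL-Combinatorics.Permutations"
begin

text \<open>An element of the symmetric group on \<open>[m]\<close> is a function \<open>w :: nat \<Rightarrow> nat\<close> with
  \<open>w permutes {1..m}\<close>; it is the identity outside \<open>{1..m}\<close>.\<close>

definition exc :: "nat \<Rightarrow> (nat \<Rightarrow> nat) \<Rightarrow> nat" where
  "exc m w = card {i \<in> {1..m}. w i > i}"

definition des :: "nat \<Rightarrow> (nat \<Rightarrow> nat) \<Rightarrow> nat" where
  "des m w = card {i \<in> {1..<m}. w i > w (i + 1)}"

definition Fix :: "nat \<Rightarrow> (nat \<Rightarrow> nat) \<Rightarrow> nat set" where
  "Fix m w = {i \<in> {1..m}. w i = i}"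

definition Dset :: "nat \<Rightarrow> nat \<Rightarrow> (nat \<Rightarrow> nat) set" where
  "Dset m k = {w. w permutes {1..m} \<and> Fix m w \<subseteq> {1..m - k}}"

text \<open>Only the values with \<open>k \<le> n\<close> and \<open>j \<le> n\<close> are meaningful.\<close>

definition dpoly :: "nat \<Rightarrow> nat \<Rightarrow> nat \<Rightarrow> real poly" where
  "dpoly n k j =
     (if n = 0 then 1
      else (\<Sum>w \<in> {w \<in> Dset (n + 1) k. inv w 1 = j + 1}. monom 1 (exc (n + 1) w)))"

definition eulerian_poly :: "nat \<Rightarrow> real poly" where
  "eulerian_poly n = (\<Sum>w \<in> {w. w permutes {1..n}}. monom 1 (des n w))"

definition real_rooted :: "real poly \<Rightarrow> bool" where
  "real_rooted p \<longleftrightarrow>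
     p = 0 \<or> (\<forall>z::complex. poly (map_poly complex_of_real p) z = 0 \<longrightarrow> z \<in> \<real>)"

text \<open>The roots with multiplicity, in weakly decreasing order.\<close>

definition roots_desc :: "real poly \<Rightarrow> real list" where
  "roots_desc p = rev (sorted_list_of_multiset (proots p))"

text \<open>The chain \<open>\<dots> \<le> \<alpha>\<^sub>2 \<le> \<beta>\<^sub>2 \<le> \<alpha>\<^sub>1 \<le> \<beta>\<^sub>1\<close> alternates through all roots of \<open>f\<close> and \<open>g\<close>,
  so \<open>g\<close> has as many roots as \<open>f\<close> or exactly one more. For nonzero constant \<open>f\<close> this gives
  the convention that \<open>f\<close> interlaces every polynomial of degree at most one.\<close>

definition interlaces :: "real poly \<Rightarrow> real poly \<Rightarrow> bool" (infix "\<preceq>" 50) where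
  "f \<preceq> g \<longleftrightarrow> real_rooted f \<and> real_rooted g \<and>
     (f = 0 \<or> g = 0 \<or>
      (let \<alpha> = roots_desc f; \<beta> = roots_desc g in
         (length \<beta> = length \<alpha> \<or> length \<beta> = length \<alpha> + 1) \<and>
         (\<forall>i < length \<alpha>. \<alpha> ! i \<le> \<beta> ! i) \<and>
         (\<forall>i. i + 1 < length \<beta> \<longrightarrow> \<beta> ! (i + 1) \<le> \<alpha> ! i)))"

definition interlacing_seq :: "nat \<Rightarrow> (nat \<Rightarrow> real poly) \<Rightarrow> bool" where
  "interlacing_seq m f \<longleftrightarrow> (\<forall>i j. i < j \<and> j \<le> m \<longrightarrow> f i \<preceq> f j)"

end

theory Submission
  imports Defs "HOL-Real_Asymp.Real_Asymp"
begin

text \<open>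
  Write \<open>d n k j\<close> for \<open>dpoly n k j\<close>. Deleting a position and a value from a permutation shows
  that the vector \<open>(d (n+1) (k+1) j)\<^sub>j\<close> arises from \<open>(d n k i)\<^sub>i\<close> by a transfer matrix with rows
  \<open>(x, \<dots>, x, \<epsilon>, 1, \<dots>, 1)\<close>, \<open>\<epsilon> \<in> {0, 1}\<close>, and that for \<open>k = 0\<close> excedances and descents obey the same
  recurrence.

  Fix \<open>z\<close> in the upper half plane and let \<open>W(u, v) = Im(cnj u * v)\<close>. The condition that the complex
  numbers \<open>c i = d n k i z\<close> satisfy \<open>W(c i, c j) \<ge> 0\<close> and \<open>W(c j, z * c i) \<ge> 0\<close> for \<open>i \<le> j\<close> is preserved
  by the transfer matrix, because \<open>W\<close> is bilinear and antisymmetric; it also keeps all entries away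
  from zero, whence real-rootedness. For real-rooted \<open>f\<close>, \<open>g\<close> with positive leading coefficients,
  \<open>W(f z, g z) \<ge> 0\<close> on the upper half plane says that the argument of \<open>g\<close> minus that of \<open>f\<close> lies in
  \<open>[0, \<pi>]\<close>. Letting \<open>z\<close> tend to a real point \<open>t\<close>, the numbers of roots above \<open>t\<close> differ by \<open>0\<close> or \<open>1\<close>,
  which is interlacing.

  For the Eulerian polynomial, \<open>A\<^sub>n = d n 0 0\<close>, and the number of roots above \<open>t\<close> increases weakly
  along the chain \<open>d n 0 0, d n 1 0, \<dots>, d n k 0, d n k j, d n k (n-k), d n k (n-k+1) = d n (k-1) (n-k+1),
  d n (k-1) (n-k+2) = d n (k-2) (n-k+2), \<dots>, d n 0 n\<close>, whose total increase is at most \<open>1\<close>.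
\<close>

section \<open>Deleting a position and a value from a permutation\<close>

text \<open>\<open>skip a\<close> is the increasing bijection from the naturals onto those different
  from \<open>a\<close>, and \<open>unskip a\<close> is its left inverse. In terms of permutation
  matrices, \<open>ins a b u\<close> adds a row and a column to \<open>u\<close> that cross in an
  entry 1 at position \<open>a\<close>, value \<open>b\<close>.\<close>

definition skip :: "nat \<Rightarrow> nat \<Rightarrow> nat" where
  "skip a i = (if i < a then i else i + 1)"

definition unskip :: "nat \<Rightarrow> nat \<Rightarrow> nat" where
  "unskip a i = (if i < a then i else i - 1)"

definition ins :: "nat \<Rightarrow> nat \<Rightarrow> (nat \<Rightarrow> nat) \<Rightarrow> nat \<Rightarrow> nat" where
  "ins a b u i = (if i = a then b else skip b (u (unskip a i)))"

lemma unskip_skip [simp]: "unskip a (skip a i) = i"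
  by (auto simp: skip_def unskip_def)

lemma skip_unskip: "i \<noteq> a \<Longrightarrow> skip a (unskip a i) = i"
  by (auto simp: skip_def unskip_def)

lemma skip_neq [simp]: "skip a i \<noteq> a"
  by (auto simp: skip_def)

lemma inj_skip: "inj (skip a)"
  by (rule inj_on_inverseI[of _ "unskip a"]) simp

lemma skip_eq_iff [simp]: "skip a i = skip a j \<longleftrightarrow> i = j"
  using inj_skip by (auto dest: injD)

lemma skip_less_iff [simp]: "skip a i < skip a j \<longleftrightarrow> i < j"
  by (auto simp: skip_def)

lemma skip_le_iff [simp]: "skip a i \<le> skip a j \<longleftrightarrow> i \<le> j"
  by (auto simp: skip_def)

lemma ins_at [simp]: "ins a b u a = b"
  by (simp add: ins_def)

lemma ins_skip [simp]: "ins a b u (skip a i) = skip b (u i)"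
  by (simp add: ins_def)

lemma skip_range: "a \<in> {1..n + 1} \<Longrightarrow> skip a i \<in> {1..n + 1} \<longleftrightarrow> i \<in> {1..n}"
  by (auto simp: skip_def)

lemma interval_eq_insert_skip:
  assumes "a \<in> {1..n + 1}"
  shows "{1..n + 1} = insert a (skip a ` {1..n})"
proof -
  have "i = a \<or> i \<in> skip a ` {1..n}" if "i \<in> {1..n + 1}" for i
    using that assms skip_unskip[of i a] skip_range[OF assms, of "unskip a i"]
    by (metis imageI)
  moreover have "skip a i \<in> {1..n + 1}" if "i \<in> {1..n}" for i
    using that skip_range[OF assms] by blast
  ultimately show ?thesis
    using assms by blast
qed

lemma card_interval_skip:
  assumes "a \<in> {1..n + 1}"
  shows "card {i \<in> {1..n + 1}. P i} = (if P a then 1 else 0) + card {i \<in> {1..n}. P (skip a i)}"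
proof -
  have eq: "{i \<in> {1..n + 1}. P i} =
      (if P a then insert a (skip a ` {i \<in> {1..n}. P (skip a i)}) else skip a ` {i \<in> {1..n}. P (skip a i)})"
    unfolding interval_eq_insert_skip[OF assms] by auto
  have c: "card (skip a ` {i \<in> {1..n}. P (skip a i)}) = card {i \<in> {1..n}. P (skip a i)}"
    by (intro card_image inj_on_subset[OF inj_skip]) auto
  have "a \<notin> skip a ` {i \<in> {1..n}. P (skip a i)}"
    by (metis imageE skip_neq)
  then show ?thesis
    unfolding eq using c by auto
qed

lemma ins_permutes:
  assumes "u permutes {1..n}" "a \<in> {1..n + 1}" "b \<in> {1..n + 1}"
  shows "ins a b u permutes {1..n + 1}"
proof (rule bij_imp_permutes)
  have "ins a b u i \<in> {1..n + 1}" if i: "i \<in> {1..n + 1}" for i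
  proof (cases "i = a")
    case False
    then obtain i' where "i = skip a i'" by (metis skip_unskip)
    with i have "i' \<in> {1..n}" using skip_range[OF assms(2)] by simp
    then have "u i' \<in> {1..n}" using assms(1) by (metis permutes_in_image)
    then show ?thesis using \<open>i = skip a i'\<close> skip_range[OF assms(3)] by simp
  qed (use assms in simp)
  moreover have "inj (ins a b u)"
  proof (rule injI)
    fix i j assume eq: "ins a b u i = ins a b u j"
    have inju: "u i = u j \<longleftrightarrow> i = j" for i j
      using assms(1) by (metis permutes_inj injD)
    consider "i = a" | i' where "i = skip a i'" by (metis skip_unskip)
    then show "i = j"
    proof cases
      case 1
      with eq show ?thesis by (metis ins_at ins_skip skip_neq skip_unskip)
    next
      case 2
      with eq have "j \<noteq> a" by (metis ins_at ins_skip skip_neq)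
      then obtain j' where "j = skip a j'" by (metis skip_unskip)
      with 2 eq inju show ?thesis by simp
    qed
  qed
  ultimately show "bij_betw (ins a b u) {1..n + 1} {1..n + 1}"
    by (metis bij_betw_def endo_inj_surj finite_atLeastAtMost image_subsetI inj_on_subset subset_UNIV)
next
  fix i assume i: "i \<notin> {1..n + 1}"
  then have "i \<noteq> a" using assms by auto
  then obtain i' where i': "i = skip a i'" by (metis skip_unskip)
  with i have "i' \<notin> {1..n}" using skip_range[OF assms(2)] by blast
  then have "u i' = i'" using assms(1) by (simp add: permutes_not_in)
  then have "ins a b u i = skip b i'" using i' by simp
  then show "ins a b u i = i"
    using i i' assms(2,3) by (auto simp: skip_def split: if_splits)
qed

lemma del_permutes:
  assumes w: "w permutes {1..n + 1}" "w a = b" and a: "a \<in> {1..n + 1}"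
  shows "(\<lambda>i. unskip b (w (skip a i))) permutes {1..n}"
proof (rule bij_imp_permutes)
  have b: "b \<in> {1..n + 1}" using w a by (metis permutes_in_image)
  have injw: "w i = w j \<longleftrightarrow> i = j" for i j
    using w(1) by (metis permutes_inj injD)
  have sk: "skip b (unskip b (w (skip a i))) = w (skip a i)" for i
    by (rule skip_unskip) (metis injw skip_neq w(2))
  have "unskip b (w (skip a i)) \<in> {1..n}" if "i \<in> {1..n}" for i
    by (metis a b permutes_in_image sk skip_range that w(1))
  moreover have "inj (\<lambda>i. unskip b (w (skip a i)))"
    by (rule injI) (metis injw sk skip_eq_iff)
  ultimately show "bij_betw (\<lambda>i. unskip b (w (skip a i))) {1..n} {1..n}"
    by (metis (no_types, lifting) bij_betw_def endo_inj_surj finite_atLeastAtMost image_subsetI inj_on_subset subset_UNIV)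
  fix i assume i: "i \<notin> {1..n}"
  then have "w (skip a i) = skip a i"
    using w(1) skip_range[OF a] by (simp add: permutes_not_in)
  then show "unskip b (w (skip a i)) = i"
    using i a b by (auto simp: skip_def unskip_def)
qed

lemma bij_betw_ins:
  assumes "a \<in> {1..n + 1}" "b \<in> {1..n + 1}"
  shows "bij_betw (ins a b) {u. u permutes {1..n}} {w. w permutes {1..n + 1} \<and> w a = b}"
proof (rule bij_betw_byWitness[where f' = "\<lambda>w i. unskip b (w (skip a i))"])
  show "\<forall>w\<in>{w. w permutes {1..n + 1} \<and> w a = b}. ins a b (\<lambda>i. unskip b (w (skip a i))) = w"
  proof (intro ballI ext)
    fix w i assume w: "w \<in> {w. w permutes {1..n + 1} \<and> w a = b}"
    then have "w i \<noteq> b" if "i \<noteq> a"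
      using that by (metis (mono_tags, lifting) injD mem_Collect_eq permutes_inj)
    with w show "ins a b (\<lambda>i. unskip b (w (skip a i))) i = w i"
      by (auto simp: ins_def skip_unskip)
  qed
qed (use ins_permutes del_permutes assms in auto)

text \<open>Source of the recurrences: prescribing one value of \<open>w\<close> reduces a sum over
  permutations of \<open>n + 1\<close> letters to one over \<open>n\<close> letters.\<close>

lemma sum_ins:
  fixes F :: "(nat \<Rightarrow> nat) \<Rightarrow> 'a :: comm_monoid_add"
  assumes "a \<in> {1..n + 1}" "b \<in> {1..n + 1}"
  shows "(\<Sum>w | w permutes {1..n + 1} \<and> w a = b \<and> Q w. F w) =
         (\<Sum>u | u permutes {1..n} \<and> Q (ins a b u). F (ins a b u))"
proof (rule sum.reindex_bij_betw[symmetric])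
  have bij: "bij_betw (ins a b) {u. u permutes {1..n}} {w. w permutes {1..n + 1} \<and> w a = b}"
    by (rule bij_betw_ins[OF assms])
  then have "bij_betw (ins a b) {u \<in> {u. u permutes {1..n}}. Q (ins a b u)}
     (ins a b ` {u \<in> {u. u permutes {1..n}}. Q (ins a b u)})"
    by (rule bij_betw_subset) auto
  also have "ins a b ` {u \<in> {u. u permutes {1..n}}. Q (ins a b u)} =
      {w \<in> ins a b ` {u. u permutes {1..n}}. Q w}" by auto
  also have "\<dots> = {w. w permutes {1..n + 1} \<and> w a = b \<and> Q w}"
    using bij by (auto simp: bij_betw_def)
  finally show "bij_betw (ins a b) {u. u permutes {1..n} \<and> Q (ins a b u)}
     {w. w permutes {1..n + 1} \<and> w a = b \<and> Q w}" by simp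
qed

section \<open>Excedance sums and the recurrence for \<open>k = 0\<close>\<close>

text \<open>For \<open>n = 0\<close> the conventional value 1 agrees with the sum, whose only term
  is the identity of \<open>{1}\<close>, without excedances.\<close>

lemma dpoly_eq_sum:
  assumes "k \<le> n" "j \<le> n"
  shows "dpoly n k j = (\<Sum>w | w permutes {1..n + 1} \<and> w (j + 1) = 1 \<and>
           (\<forall>i \<in> {1..n + 1}. w i = i \<longrightarrow> i \<le> n + 1 - k). monom 1 (exc (n + 1) w))"
proof (cases "n = 0")
  case True
  then have "{w. w permutes {1..n + 1} \<and> w (j + 1) = 1 \<and>
           (\<forall>i \<in> {1..n + 1}. w i = i \<longrightarrow> i \<le> n + 1 - k)} = {id}"
    using assms by (auto simp: permutes_sing)
  moreover have "exc (n + 1) id = 0"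
    by (auto simp: exc_def)
  ultimately show ?thesis
    using True by (simp add: dpoly_def)
next
  case False
  have "inv w 1 = j + 1 \<longleftrightarrow> w (j + 1) = 1" if "w permutes {1..n + 1}" for w
    using that by (metis permutes_inv_eq)
  then have "{w \<in> Dset (n + 1) k. inv w 1 = j + 1} =
    {w. w permutes {1..n + 1} \<and> w (j + 1) = 1 \<and>
           (\<forall>i \<in> {1..n + 1}. w i = i \<longrightarrow> i \<le> n + 1 - k)}"
    by (fastforce simp: Dset_def Fix_def)
  with False show ?thesis
    by (simp add: dpoly_def)
qed

text \<open>The excedance number of \<open>ins (j + 1) 1 u\<close>, read off from \<open>u\<close>:
  all values move up by one, but positions up to \<open>j\<close> stay in place, so there weak
  excedances become strict; later positions move along with the values.\<close>

definition wexc :: "nat \<Rightarrow> nat \<Rightarrow> (nat \<Rightarrow> nat) \<Rightarrow> nat" where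
  "wexc j n u = card {i \<in> {1..n}. if i \<le> j then i \<le> u i else i < u i}"

lemma dpoly_0_eq_sum_wexc:
  assumes "j \<le> n"
  shows "dpoly n 0 j = (\<Sum>u | u permutes {1..n}. monom 1 (wexc j n u))"
proof -
  have "dpoly n 0 j = (\<Sum>w | w permutes {1..n + 1} \<and> w (j + 1) = 1 \<and> True. monom 1 (exc (n + 1) w))"
    using assms by (subst dpoly_eq_sum) (auto intro!: sum.cong)
  also have "\<dots> = (\<Sum>u | u permutes {1..n} \<and> True. monom 1 (exc (n + 1) (ins (j + 1) 1 u)))"
    using assms by (intro sum_ins) auto
  also have "\<dots> = (\<Sum>u | u permutes {1..n}. monom 1 (wexc j n u))"
  proof (intro sum.cong arg_cong2[of _ _ _ _ monom])
    fix u assume "u \<in> {u. u permutes {1..n}}"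
    then have u: "u i \<ge> 1" if "i \<in> {1..n}" for i
      using that by (metis atLeastAtMost_iff mem_Collect_eq permutes_in_image)
    have "exc (n + 1) (ins (j + 1) 1 u) = card {i \<in> {1..n}. skip (j + 1) i < skip 1 (u i)}"
      unfolding exc_def using assms by (subst card_interval_skip[of "j + 1"]) auto
    also have "\<dots> = wexc j n u"
      unfolding wexc_def using u by (intro arg_cong[of _ _ card]) (force simp: skip_def)
    finally show "exc (n + 1) (ins (j + 1) 1 u) = wexc j n u" .
  qed auto
  finally show ?thesis .
qed

text \<open>The statistics \<open>wexc (j + 1)\<close> and \<open>wexc j\<close> differ only at
  position \<open>j + 1\<close>, and only if that is a fixed point, where they are
  \<open>1 + r u\<close> and \<open>r u\<close>. Deleting this fixed point leaves an arbitrary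
  permutation of \<open>n\<close> letters with \<open>r\<close> turned into
  \<open>wexc j n\<close>.\<close>

lemma dpoly_0_diff:
  assumes "j \<le> n"
  shows "dpoly (n + 1) 0 (j + 1) - dpoly (n + 1) 0 j = [:-1, 1:] * dpoly n 0 j"
proof -
  define r where "r u = card {i \<in> {1..n}. if skip (j + 1) i \<le> j then skip (j + 1) i \<le> u (skip (j + 1) i)
    else skip (j + 1) i < u (skip (j + 1) i)}" for u :: "nat \<Rightarrow> nat"
  have le: "skip (j + 1) i \<le> j + 1 \<longleftrightarrow> skip (j + 1) i \<le> j" for i
    using skip_neq[of "j + 1" i] by linarith
  have w1: "wexc (j + 1) (n + 1) u = (if j + 1 \<le> u (j + 1) then 1 else 0) + r u" for u
    unfolding wexc_def r_def using assms by (subst card_interval_skip[of "j + 1"]) (simp_all add: le del: One_nat_def add_Suc_right)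
  have w0: "wexc j (n + 1) u = (if j + 1 < u (j + 1) then 1 else 0) + r u" for u
    unfolding wexc_def r_def using assms by (subst card_interval_skip[of "j + 1"]) (auto simp: le)
  have r: "r (ins (j + 1) (j + 1) u) = wexc j n u" for u
  proof -
    have "skip (j + 1) i \<le> j \<longleftrightarrow> i \<le> j" for i
      by (auto simp: skip_def)
    then show ?thesis unfolding r_def wexc_def by simp
  qed
  have "dpoly (n + 1) 0 (j + 1) - dpoly (n + 1) 0 j =
     (\<Sum>u | u permutes {1..n + 1}. monom 1 (wexc (j + 1) (n + 1) u) - monom 1 (wexc j (n + 1) u))"
    using assms by (simp add: dpoly_0_eq_sum_wexc sum_subtractf)
  also have "\<dots> = (\<Sum>u | u permutes {1..n + 1} \<and> u (j + 1) = j + 1 \<and> True. monom 1 (1 + r u) - monom 1 (r u))"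
    by (rule sum.mono_neutral_cong_right) (auto simp: w0[simplified] w1[simplified] finite_permutations)
  also have "\<dots> = (\<Sum>u | u permutes {1..n} \<and> True. monom 1 (1 + wexc j n u) - monom 1 (wexc j n u))"
    using assms by (subst sum_ins) (auto simp: r[simplified])
  also have "\<dots> = [:-1, 1:] * dpoly n 0 j"
    using assms by (auto simp: dpoly_0_eq_sum_wexc sum_distrib_left monom_Suc intro!: sum.cong)
  finally show ?thesis .
qed

lemma sum_permutations_by_position:
  fixes F :: "(nat \<Rightarrow> nat) \<Rightarrow> 'a :: comm_monoid_add"
  assumes "b \<in> {1..n + 1}"
  shows "(\<Sum>u | u permutes {1..n + 1}. F u) =
    (\<Sum>i\<le>n. \<Sum>u | u permutes {1..n + 1} \<and> u (i + 1) = b. F u)"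
proof -
  have "{u. u permutes {1..n + 1}} = (\<Union>i\<in>{..n}. {u. u permutes {1..n + 1} \<and> u (i + 1) = b})"
  proof (rule set_eqI, rule iffI)
    fix u assume "u \<in> {u. u permutes {1..n + 1}}"
    then have u: "u permutes {1..n + 1}" by simp
    then obtain i where i: "u i = b" by (metis permutes_inverses(1))
    then have "i \<in> {1..n + 1}" using u assms by (metis permutes_in_image)
    then show "u \<in> (\<Union>i\<in>{..n}. {u. u permutes {1..n + 1} \<and> u (i + 1) = b})"
      using u i by (auto intro!: bexI[of _ "i - 1"])
  qed auto
  then have "(\<Sum>u | u permutes {1..n + 1}. F u) =
     sum F (\<Union>i\<in>{..n}. {u. u permutes {1..n + 1} \<and> u (i + 1) = b})" by simp
  also have "\<dots> = (\<Sum>i\<le>n. \<Sum>u | u permutes {1..n + 1} \<and> u (i + 1) = b. F u)"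
  proof (rule sum.UNION_disjoint)
    show "\<forall>i\<in>{..n}. \<forall>j\<in>{..n}. i \<noteq> j \<longrightarrow> {u. u permutes {1..n + 1} \<and> u (i + 1) = b} \<inter>
       {u. u permutes {1..n + 1} \<and> u (j + 1) = b} = {}"
    proof -
      have False if "u permutes {1..n+1}" "u (i+1) = b" "u (j+1) = b" "i \<noteq> j" for u i j
        using that by (metis add_right_cancel injD permutes_inj)
      then show ?thesis by auto
    qed
  qed (auto simp: finite_permutations)
  finally show ?thesis .
qed

lemma sum_permutations_by_value:
  fixes F :: "(nat \<Rightarrow> nat) \<Rightarrow> 'a :: comm_monoid_add"
  assumes "a \<in> {1..n + 1}"
  shows "(\<Sum>u | u permutes {1..n + 1}. F u) =
    (\<Sum>i\<le>n. \<Sum>u | u permutes {1..n + 1} \<and> u a = i + 1. F u)"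
proof -
  have "{u. u permutes {1..n + 1}} = (\<Union>i\<in>{..n}. {u. u permutes {1..n + 1} \<and> u a = i + 1})"
  proof (rule set_eqI, rule iffI)
    fix u assume "u \<in> {u. u permutes {1..n + 1}}"
    then have u: "u permutes {1..n + 1}" by simp
    then have "u a \<in> {1..n + 1}" using assms by (metis permutes_in_image)
    then show "u \<in> (\<Union>i\<in>{..n}. {u. u permutes {1..n + 1} \<and> u a = i + 1})"
      using u by (auto intro!: bexI[of _ "u a - 1"])
  qed auto
  then have "(\<Sum>u | u permutes {1..n + 1}. F u) =
     sum F (\<Union>i\<in>{..n}. {u. u permutes {1..n + 1} \<and> u a = i + 1})" by simp
  also have "\<dots> = (\<Sum>i\<le>n. \<Sum>u | u permutes {1..n + 1} \<and> u a = i + 1. F u)"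
    by (rule sum.UNION_disjoint) (auto simp: finite_permutations)
  finally show ?thesis .
qed

text \<open>\<open>wexc 0\<close> is the ordinary excedance number, so the left side runs over all
  permutations of \<open>n + 1\<close> letters; these are sorted by the position of the value
  1.\<close>

lemma dpoly_0_0_eq_sum: "dpoly (n + 1) 0 0 = (\<Sum>i\<le>n. dpoly n 0 i)"
proof -
  have "dpoly (n + 1) 0 0 = (\<Sum>u | u permutes {1..n + 1}. monom 1 (exc (n + 1) u))"
    by (subst dpoly_0_eq_sum_wexc) (auto simp: wexc_def exc_def intro!: sum.cong arg_cong2[of _ _ _ _ monom] arg_cong[of _ _ card])
  also have "\<dots> = (\<Sum>i\<le>n. \<Sum>u | u permutes {1..n + 1} \<and> u (i + 1) = 1. monom 1 (exc (n + 1) u))"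
    by (rule sum_permutations_by_position) simp
  also have "\<dots> = (\<Sum>i\<le>n. dpoly n 0 i)"
    by (rule sum.cong) (auto simp: dpoly_eq_sum intro!: sum.cong)
  finally show ?thesis .
qed

lemma dpoly_0_rec:
  assumes "j \<le> n + 1"
  shows "dpoly (n + 1) 0 j = [:0, 1:] * (\<Sum>i<j. dpoly n 0 i) + (\<Sum>i=j..<n + 1. dpoly n 0 i)"
  using assms
proof (induction j)
  case 0
  then show ?case by (simp add: dpoly_0_0_eq_sum[simplified] atLeast0LessThan lessThan_Suc_atMost)
next
  case (Suc j)
  have "dpoly (n + 1) 0 (Suc j) = dpoly (n + 1) 0 j + [:-1, 1:] * dpoly n 0 j"
    using dpoly_0_diff[of j n] Suc.prems by (simp add: algebra_simps)
  also have "\<dots> = [:0, 1:] * (\<Sum>i<j. dpoly n 0 i) + (\<Sum>i=j..<n + 1. dpoly n 0 i) + [:-1, 1:] * dpoly n 0 j"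
    using Suc by simp
  also have "(\<Sum>i=j..<n + 1. dpoly n 0 i) = dpoly n 0 j + (\<Sum>i=Suc j..<n + 1. dpoly n 0 i)"
    using Suc.prems by (intro sum.atLeast_Suc_lessThan) simp
  finally show ?case by (simp add: algebra_simps)
qed

section \<open>Descents refined by the first value\<close>

definition des_poly :: "nat \<Rightarrow> nat \<Rightarrow> real poly" where
  "des_poly n j = (\<Sum>w | w permutes {1..n + 1} \<and> w 1 = j + 1. monom 1 (des (n + 1) w))"

text \<open>Deleting the first value \<open>j + 1\<close> and standardizing loses a descent exactly
  when the next value, after standardizing, is at most \<open>j\<close>. The result is the
  recurrence of \<open>dpoly_0_rec\<close>.\<close>

lemma des_poly_rec:
  assumes "j \<le> n + 1"
  shows "des_poly (n + 1) j = [:0, 1:] * (\<Sum>i<j. des_poly n i) + (\<Sum>i=j..<n + 1. des_poly n i)"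
proof -
  have des: "des (n + 2) (ins 1 (j + 1) u) = (if u 1 \<le> j then 1 else 0) + des (n + 1) u" for u
  proof -
    let ?w = "ins 1 (j + 1) u"
    have w: "?w (i + 1) = skip (j + 1) (u i)" if "i \<ge> 1" for i
      using that ins_skip[of 1 "j + 1" u i] by (simp add: skip_def)
    have "des (n + 2) ?w = card {i \<in> {1..n + 1}. ?w i > ?w (i + 1)}"
      unfolding des_def by (rule arg_cong[of _ _ card]) auto
    also have "\<dots> = (if ?w 1 > ?w (1 + 1) then 1 else 0) +
        card {i \<in> {1..n}. ?w (skip 1 i) > ?w (skip 1 i + 1)}"
      by (subst card_interval_skip[of 1]) auto
    also have "?w 1 > ?w (1 + 1) \<longleftrightarrow> u 1 \<le> j"
      by (subst w) (auto simp: skip_def)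
    also have "{i \<in> {1..n}. ?w (skip 1 i) > ?w (skip 1 i + 1)} = {i \<in> {1..<n + 1}. u i > u (i + 1)}"
    proof -
      have "?w (skip 1 i) > ?w (skip 1 i + 1) \<longleftrightarrow> u i > u (i + 1)" if "i \<in> {1..n}" for i
      proof -
        have "skip 1 i = i + 1" using that by (auto simp: skip_def)
        then show ?thesis using that w[of i] w[of "i + 1"]
          by (auto simp: skip_def split: if_splits)
      qed
      then show ?thesis by auto
    qed
    finally show ?thesis by (simp add: des_def)
  qed
  have "des_poly (n + 1) j = (\<Sum>w | w permutes {1..(n + 1) + 1} \<and> w 1 = j + 1 \<and> True. monom 1 (des (n + 2) w))"
    by (simp add: des_poly_def)
  also have "\<dots> = (\<Sum>u | u permutes {1..n + 1} \<and> True. monom 1 (des (n + 2) (ins 1 (j + 1) u)))"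
    using assms by (intro sum_ins) auto
  also have "\<dots> = (\<Sum>u | u permutes {1..n + 1}. monom 1 ((if u 1 \<le> j then 1 else 0) + des (n + 1) u))"
    by (simp only: des simp_thms)
  also have "\<dots> = (\<Sum>i\<le>n. \<Sum>u | u permutes {1..n + 1} \<and> u 1 = i + 1.
      monom 1 ((if u 1 \<le> j then 1 else 0) + des (n + 1) u))"
    by (rule sum_permutations_by_value) simp
  also have "\<dots> = (\<Sum>i\<le>n. (if i < j then [:0, 1:] else 1) * des_poly n i)"
    by (rule sum.cong) (auto simp: des_poly_def sum_distrib_left monom_Suc intro!: sum.cong)
  also have "\<dots> = (\<Sum>i\<in>{..<j} \<union> {j..<n + 1}. (if i < j then [:0, 1:] else 1) * des_poly n i)"
    using assms by (intro sum.cong) auto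
  also have "\<dots> = [:0, 1:] * (\<Sum>i<j. des_poly n i) + (\<Sum>i=j..<n + 1. des_poly n i)"
    by (subst sum.union_disjoint) (auto simp: sum_distrib_left)
  finally show ?thesis .
qed

lemma des_poly_eq_dpoly: "j \<le> n \<Longrightarrow> des_poly n j = dpoly n 0 j"
proof (induction n arbitrary: j)
  case 0
  have "{w. w permutes {1..0 + 1} \<and> w 1 = j + 1} = {id}"
    using 0 by (auto simp: permutes_sing)
  then show ?case using 0 by (simp add: des_poly_def dpoly_def des_def)
next
  case (Suc n)
  then show ?case
    using des_poly_rec[of j n] dpoly_0_rec[of j n] by simp
qed

lemma eulerian_poly_eq_dpoly: "eulerian_poly n = dpoly n 0 0"
proof (cases n)
  case 0
  then show ?thesis by (simp add: eulerian_poly_def dpoly_def des_def)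
next
  case (Suc m)
  have "eulerian_poly n = (\<Sum>i\<le>m. des_poly m i)"
    unfolding eulerian_poly_def des_poly_def Suc Suc_eq_plus1
    by (rule sum_permutations_by_value) simp
  also have "\<dots> = dpoly n 0 0"
    using Suc by (simp add: des_poly_eq_dpoly dpoly_0_0_eq_sum[simplified])
  finally show ?thesis .
qed

section \<open>Lowering the bound on fixed points\<close>

text \<open>The permutations counted for \<open>k\<close> but not for \<open>k + 1\<close> are those
  that fix \<open>a = n + 2 - k\<close>, the largest position where a fixed point is allowed.
  Deleting this fixed point preserves excedances. The position of 1 stays if it is before
  \<open>a\<close> and moves left by one if it is after \<open>a\<close>; it cannot be
  \<open>a\<close> itself, since \<open>a \<ge> 2\<close>.\<close>

lemma dpoly_Suc_k:
  assumes "k \<le> n" "j \<le> n + 1"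
  shows "dpoly (n + 1) k j = dpoly (n + 1) (k + 1) j +
     (if j < n + 1 - k then dpoly n k j else if j = n + 1 - k then 0 else dpoly n k (j - 1))"
proof -
  define a where "a = n + 2 - k"
  have a: "a \<in> {1..(n + 1) + 1}" "a \<ge> 2" using assms by (auto simp: a_def)
  let ?Q = "\<lambda>w. w (j + 1) = 1 \<and> (\<forall>i \<in> {1..n + 2}. w i = i \<longrightarrow> i \<le> a)"
  let ?X = "{w. w permutes {1..n + 2} \<and> ?Q w}"
  have "dpoly (n + 1) k j = (\<Sum>w\<in>?X. monom 1 (exc (n + 2) w))"
    using assms by (simp add: dpoly_eq_sum a_def)
  also have "?X = {w. w permutes {1..n + 2} \<and> w (j + 1) = 1 \<and> (\<forall>i \<in> {1..n + 2}. w i = i \<longrightarrow> i \<le> n + 2 - (k + 1))}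
     \<union> {w. w permutes {1..n + 2} \<and> w a = a \<and> ?Q w}" (is "_ = ?Y \<union> ?Z")
  proof -
    have "(i \<le> a) = (i \<le> n + 2 - (k + 1) \<or> i = a)" for i
      using assms by (auto simp: a_def)
    moreover have "a \<in> {1..n + 2}" using a by simp
    ultimately show ?thesis by blast
  qed
  also have "(\<Sum>w\<in>?Y \<union> ?Z. monom 1 (exc (n + 2) w)) =
     (\<Sum>w\<in>?Y. monom 1 (exc (n + 2) w)) + (\<Sum>w\<in>?Z. monom 1 (exc (n + 2) w))"
  proof (rule sum.union_disjoint)
    have "\<not> a \<le> n + 2 - (k + 1)" using assms by (simp add: a_def)
    moreover have "a \<in> {1..n + 2}" using a by simp
    ultimately show "?Y \<inter> ?Z = {}" by blast
  qed (auto simp: finite_permutations)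
  also have "(\<Sum>w\<in>?Y. monom 1 (exc (n + 2) w)) = dpoly (n + 1) (k + 1) j"
    using assms by (simp add: dpoly_eq_sum)
  also have "(\<Sum>w\<in>?Z. monom 1 (exc (n + 2) w)) =
     (\<Sum>u | u permutes {1..n + 1} \<and> ?Q (ins a a u). monom (1::real) (exc (n + 2) (ins a a u)))"
    using sum_ins[OF a(1) a(1), where Q = ?Q and F = "\<lambda>w. monom 1 (exc (n + 2) w)"] by simp
  also have "\<dots> = (\<Sum>u | u permutes {1..n + 1} \<and> ?Q (ins a a u). monom 1 (exc (n + 1) u))"
  proof (intro sum.cong arg_cong2[of _ _ _ _ monom] refl)
    fix u :: "nat \<Rightarrow> nat"
    show "exc (n + 2) (ins a a u) = exc (n + 1) u"
      unfolding exc_def using card_interval_skip[OF a(1), of "\<lambda>i. i < ins a a u i"]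
      by simp
  qed
  also have "\<dots> = (if j < n + 1 - k then dpoly n k j else if j = n + 1 - k then 0 else dpoly n k (j - 1))"
  proof -
    have eq1: "skip a i = 1 \<longleftrightarrow> i = 1" for i
      using a(2) by (auto simp: skip_def)
    have fx: "(\<forall>i \<in> {1..n + 2}. ins a a u i = i \<longrightarrow> i \<le> a) \<longleftrightarrow>
        (\<forall>i \<in> {1..n + 1}. u i = i \<longrightarrow> i \<le> n + 1 - k)" for u
    proof -
      have "skip a i \<le> a \<longleftrightarrow> i \<le> n + 1 - k" for i
        using assms by (auto simp: skip_def a_def)
      moreover have "{1..n + 2} = insert a (skip a ` {1..n + 1})"
        using interval_eq_insert_skip[OF a(1)] by simp
      ultimately show ?thesis by simp
    qed
    consider "j + 1 < a" | "j + 1 = a" | "j + 1 > a" by linarith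
    then show ?thesis
    proof cases
      case 1
      then have "ins a a u (j + 1) = skip a (u (j + 1))" for u
        by (simp add: ins_def unskip_def)
      then have "?Q (ins a a u) \<longleftrightarrow> u (j + 1) = 1 \<and>
          (\<forall>i \<in> {1..n + 1}. u i = i \<longrightarrow> i \<le> n + 1 - k)" for u
        by (simp only: eq1 fx)
      moreover have "j < n + 1 - k" "j \<le> n" using 1 assms by (auto simp: a_def)
      ultimately show ?thesis
        using assms by (simp only: dpoly_eq_sum if_True)
    next
      case 2
      then show ?thesis using a(2) by (auto simp: a_def)
    next
      case 3
      then have "ins a a u (j + 1) = skip a (u ((j - 1) + 1))" for u
        using a(2) by (simp add: ins_def unskip_def)
      then have "?Q (ins a a u) \<longleftrightarrow> u ((j - 1) + 1) = 1 \<and>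
          (\<forall>i \<in> {1..n + 1}. u i = i \<longrightarrow> i \<le> n + 1 - k)" for u
        by (simp only: eq1 fx)
      moreover have "\<not> j < n + 1 - k" "j \<noteq> n + 1 - k" "j - 1 \<le> n"
        using 3 assms by (auto simp: a_def)
      ultimately show ?thesis
        using assms by (simp only: dpoly_eq_sum if_False)
    qed
  qed
  finally show ?thesis .
qed

section \<open>The transfer matrix\<close>

text \<open>Prefix sums of a sequence into which a 0 has been inserted at index \<open>g\<close>, as
  in the correction term of \<open>dpoly_Suc_k\<close>.\<close>

lemma sum_lessThan_gap:
  fixes s :: "nat \<Rightarrow> 'a :: comm_monoid_add"
  shows "(\<Sum>i<j. if i < g then s i else if i = g then 0 else s (i - 1)) =
         (if j \<le> g then \<Sum>i<j. s i else \<Sum>i<j - 1. s i)"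
proof (induction j)
  case (Suc j)
  consider "j < g" | "j = g" | "j > g" by linarith
  then show ?case
  proof cases
    case 3
    then obtain j' where "j = Suc j'" by (cases j) auto
    with 3 Suc show ?thesis by simp
  qed (use Suc in auto)
qed simp

text \<open>Prefix sums turn the recurrence into an identity of ring elements, which suits induction
  on \<open>k\<close>: by \<open>dpoly_Suc_k\<close> both sides for \<open>k + 1\<close> arise from
  those for \<open>k\<close> by subtracting a correction, and the corrections match by the
  hypothesis for the smaller \<open>n\<close>.\<close>

lemma dpoly_rec_psum:
  assumes "k \<le> n" "j \<le> n + 1"
  shows "dpoly (n + 1) (k + 1) j = [:0, 1:] * (\<Sum>i<j. dpoly n k i) +
    (\<Sum>i<n + 1. dpoly n k i) - (\<Sum>i<(if j < n + 1 - k then j + 1 else j). dpoly n k i)"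
  using assms
proof (induction k arbitrary: n j)
  case 0
  have "(\<Sum>i=j..<n + 1. dpoly n 0 i) = (\<Sum>i<n + 1. dpoly n 0 i) - (\<Sum>i<j. dpoly n 0 i)"
    using 0 sum_diff[of "{..<n + 1}" "{..<j}" "dpoly n 0"] lessThan_minus_lessThan[of "n + 1" j] by simp
  moreover have "dpoly (n + 1) 0 j = dpoly (n + 1) 1 j + (if j < n + 1 then dpoly n 0 j else 0)"
    using dpoly_Suc_k[of 0 n j] 0 by auto
  ultimately show ?case
    using dpoly_0_rec[OF 0(2)] 0 by (auto simp: algebra_simps)
next
  case (Suc k)
  then obtain m where n: "n = m + 1" by (cases n) auto
  define X where "X = [:0, 1 :: real:]"
  \<comment> \<open>\<open>g\<close> is the column of the inserted zero in the row
    \<open>dpoly n k\<close>; \<open>P\<close> and \<open>S\<close> are prefix sums of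
    \<open>dpoly n (k + 1)\<close> and \<open>dpoly m k\<close>, and \<open>L\<close> is
    \<open>S\<close> with the gap.\<close>
  define g where "g = n - k"
  have g: "n + 1 - Suc k = g" "n + 1 - k = g + 1" "m + 1 - k = g" "1 \<le> g" "g \<le> n"
    using Suc.prems n by (auto simp: g_def)
  define s where "s = dpoly m k"
  define f where "f = dpoly n (k + 1)"
  define S where "S j = (\<Sum>i<j. s i)" for j
  define P where "P j = (\<Sum>i<j. f i)" for j
  define L where "L j = (if j \<le> g then S j else S (j - 1))" for j
  have PL: "(\<Sum>i<j. dpoly n k i) = P j + L j" if "j \<le> n + 1" for j
  proof -
    have "(\<Sum>i<j. dpoly n k i) = (\<Sum>i<j. f i + (if i < g then s i else if i = g then 0 else s (i - 1)))"
    proof (rule sum.cong)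
      fix i assume "i \<in> {..<j}"
      then show "dpoly n k i = f i + (if i < g then s i else if i = g then 0 else s (i - 1))"
        using dpoly_Suc_k[of k m i] Suc.prems that n g unfolding f_def s_def by simp
    qed simp
    then show ?thesis
      by (simp add: sum.distrib P_def L_def S_def sum_lessThan_gap)
  qed
  have IHf: "f j = X * S j + S n - S (if j < g then j + 1 else j)" if "j \<le> n" for j
    using Suc.IH[of m j] that Suc.prems n g unfolding f_def S_def s_def X_def by simp
  have Sucj: "P (j + 1) = P j + f j" by (simp add: P_def)
  have Ln: "L (n + 1) = S n" using g by (simp add: L_def)
  have IHn: "dpoly (n + 1) (k + 1) j = X * (P j + L j) + (P (n + 1) + S n) -
      (P (if j \<le> g then j + 1 else j) + L (if j \<le> g then j + 1 else j))"
    using Suc.IH[of n j] Suc.prems g PL[of j] PL[of "j + 1"] PL[of "n + 1"] Ln by (auto simp: less_Suc_eq_le X_def)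
  have D: "dpoly (n + 1) (k + 1) j = dpoly (n + 1) (Suc k + 1) j +
     (if j < g then f j else if j = g then 0 else f (j - 1))"
    using dpoly_Suc_k[of "k + 1" n j] Suc.prems g by (simp add: f_def)
  have "dpoly (n + 1) (Suc k + 1) j = X * P j + P (n + 1) - P (if j < g then j + 1 else j)"
  proof -
    \<comment> \<open>In each case the terms in \<open>S\<close> add up to a value of
      \<open>f\<close>. Away from the gap it cancels the correction in \<open>D\<close>; at the gap
      it turns \<open>P (g + 1)\<close> into \<open>P g\<close>.\<close>
    consider "j < g" | "j = g" | "j > g" by linarith
    then show ?thesis
    proof cases
      case 1
      with D IHn IHf[of j] g show ?thesis
        by (simp add: L_def algebra_simps)
    next
      case 2
      with D IHn IHf[of j] g Sucj show ?thesis
        by (simp add: L_def algebra_simps)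
    next
      case 3
      then have "f (j - 1) = X * S (j - 1) + S n - S (j - 1)"
        using IHf[of "j - 1"] Suc.prems by auto
      with 3 D IHn g show ?thesis
        by (simp add: L_def algebra_simps)
    qed
  qed
  then show ?case by (simp add: P_def f_def g_def X_def)
qed

text \<open>Row \<open>j\<close> of the transfer matrix: \<open>x\<close> left of the diagonal, 1 to
  the right, and on the diagonal 0 for \<open>j < m\<close> and 1 otherwise. The type is generic so
  that the same operator acts on polynomials and on their complex values.\<close>

definition step :: "nat \<Rightarrow> nat \<Rightarrow> 'a :: comm_semiring_1 \<Rightarrow> (nat \<Rightarrow> 'a) \<Rightarrow> nat \<Rightarrow> 'a" where
  "step m n x c j = x * (\<Sum>i<j. c i) + (\<Sum>i=(if j < m then j + 1 else j)..<n. c i)"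

lemma dpoly_0_step: "j \<le> n + 1 \<Longrightarrow> dpoly (n + 1) 0 j = step 0 (n + 1) [:0, 1:] (dpoly n 0) j"
  using dpoly_0_rec unfolding step_def by simp

lemma dpoly_Suc_step:
  assumes "k \<le> n" "j \<le> n + 1"
  shows "dpoly (n + 1) (k + 1) j = step (n + 1 - k) (n + 1) [:0, 1:] (dpoly n k) j"
proof -
  define l where "l = (if j < n + 1 - k then j + 1 else j)"
  have "l \<le> n + 1" using assms by (auto simp: l_def)
  then have "(\<Sum>i=l..<n + 1. dpoly n k i) = (\<Sum>i<n + 1. dpoly n k i) - (\<Sum>i<l. dpoly n k i)"
    using sum_diff[of "{..<n + 1}" "{..<l}" "dpoly n k"] lessThan_minus_lessThan[of "n + 1" l] by simp
  then show ?thesis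
    using dpoly_rec_psum[OF assms] unfolding step_def l_def[symmetric] by simp
qed

section \<open>Sectors in the complex plane\<close>

text \<open>For arguments \<open>a\<close>, \<open>b\<close> of \<open>u\<close>, \<open>v\<close>
  this is \<open>cmod u * cmod v * sin (b - a)\<close>, the determinant of \<open>u\<close> and
  \<open>v\<close> as plane vectors.\<close>

definition W :: "complex \<Rightarrow> complex \<Rightarrow> real" where
  "W u v = Im (cnj u * v)"

lemma W_add_left: "W (u + u') v = W u v + W u' v"
  and W_add_right: "W u (v + v') = W u v + W u v'"
  by (simp_all add: W_def algebra_simps)

lemma W_sum_left: "W (sum f A) v = (\<Sum>a\<in>A. W (f a) v)"
  and W_sum_right: "W u (sum f A) = (\<Sum>a\<in>A. W u (f a))"
  by (simp_all add: W_def sum_distrib_left sum_distrib_right cnj_sum)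

lemma W_self [simp]: "W u u = 0"
  by (simp add: W_def)

lemma W_0 [simp]: "W u 0 = 0" "W 0 u = 0"
  by (simp_all add: W_def)

lemma W_mult_mult: "W (z * u) (z * v) = (cmod z)\<^sup>2 * W u v"
  unfolding W_def cmod_power2 by (simp add: algebra_simps power2_eq_square)

lemma W_mult_self: "W u (z * u) = Im z * (cmod u)\<^sup>2"
  unfolding W_def cmod_power2 by (simp add: algebra_simps power2_eq_square)

lemma W_mult_self_nonneg: "0 < Im z \<Longrightarrow> W u (z * u) \<ge> 0"
  by (simp add: W_mult_self)

text \<open>The values \<open>c i\<close> have weakly increasing arguments, and all lie within the angle \<open>Arg z\<close>.\<close>

definition sector :: "complex \<Rightarrow> nat \<Rightarrow> (nat \<Rightarrow> complex) \<Rightarrow> bool" where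
  "sector z n c \<longleftrightarrow> (\<forall>i j. i \<le> j \<and> j < n \<longrightarrow> W (c i) (c j) \<ge> 0 \<and> W (c j) (z * c i) \<ge> 0)"

lemma W_sums_nonneg:
  assumes "sector z n c" "\<forall>i\<in>I. \<forall>j\<in>J. i \<le> j \<and> j < n"
  shows "W (sum c I) (sum c J) \<ge> 0" "W (sum c J) (z * sum c I) \<ge> 0"
  using assms unfolding sector_def
  by (auto simp: W_sum_left W_sum_right sum_distrib_left intro!: sum_nonneg)

text \<open>The parts \<open>z * a + e\<close> common to both arguments contribute nothing that could be negative.\<close>

lemma W_blocks_nonneg:
  assumes z: "0 < Im z"
    and le: "W a b \<ge> 0" "W a c \<ge> 0" "W a d \<ge> 0" "W a e \<ge> 0" "W b c \<ge> 0" "W b d \<ge> 0" "W b e \<ge> 0"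
      "W c d \<ge> 0" "W c e \<ge> 0" "W d e \<ge> 0"
    and ge: "W b (z * a) \<ge> 0" "W c (z * a) \<ge> 0" "W d (z * a) \<ge> 0" "W e (z * a) \<ge> 0"
      "W c (z * b) \<ge> 0" "W d (z * b) \<ge> 0" "W e (z * b) \<ge> 0"
      "W d (z * c) \<ge> 0" "W e (z * c) \<ge> 0" "W e (z * d) \<ge> 0"
  shows "W (z * a + c + d + e) (z * a + z * b + z * c + e) \<ge> 0"
    and "W (z * a + z * b + z * c + e) (z * (z * a + c + d + e)) \<ge> 0"
proof -
  define u where "u = z * a + e"
  have zz: "W (z * x) (z * y) \<ge> 0" if "W x y \<ge> 0" for x y
    using that by (simp add: W_mult_mult)
  have u: "W u (z * b) \<ge> 0" "W u (z * c) \<ge> 0" "W c u \<ge> 0" "W d u \<ge> 0" "W u (z * d) \<ge> 0"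
     "W b u \<ge> 0"
    unfolding u_def W_add_left W_add_right by (intro add_nonneg_nonneg zz le ge)+
  have "W (z * a + c + d + e) (z * a + z * b + z * c + e) = W (u + c + d) (u + z * b + z * c)"
    by (simp add: u_def algebra_simps)
  also have "\<dots> \<ge> 0"
    unfolding W_add_left W_add_right
    by (intro add_nonneg_nonneg zz u le ge W_mult_self_nonneg[OF z]) simp
  finally show "W (z * a + c + d + e) (z * a + z * b + z * c + e) \<ge> 0" .
  have "W (z * a + z * b + z * c + e) (z * (z * a + c + d + e)) =
      W (u + z * b + z * c) (z * u + z * c + z * d)"
    by (simp add: u_def algebra_simps)
  also have "\<dots> \<ge> 0"
    unfolding W_add_left W_add_right
    by (intro add_nonneg_nonneg zz u le ge W_mult_self_nonneg[OF z]) simp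
  finally show "W (z * a + z * b + z * c + e) (z * (z * a + c + d + e)) \<ge> 0" .
qed

text \<open>For rows \<open>j < j'\<close> the columns fall into consecutive blocks \<open>A\<close>
  to \<open>E\<close> on which the pair of coefficients is constant: \<open>(z, z)\<close>,
  \<open>(0, z)\<close>, \<open>(1, z)\<close>, \<open>(1, 0)\<close>, \<open>(1, 1)\<close>. The
  blocks \<open>B\<close> and \<open>D\<close> hold at most the diagonal column. By bilinearity the
  block sums inherit the sector inequalities, and \<open>W_blocks_nonneg\<close> applies.\<close>

lemma sector_step:
  assumes z: "0 < Im z" and c: "sector z n c" and m: "m \<le> n"
  shows "sector z (n + 1) (step m n z c)"
  unfolding sector_def
proof (intro allI impI)
  fix j j' assume "j \<le> j' \<and> j' < n + 1"
  then have j: "j \<le> j'" "j' \<le> n" by auto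
  show "W (step m n z c j) (step m n z c j') \<ge> 0 \<and> W (step m n z c j') (z * step m n z c j) \<ge> 0"
  proof (cases "j = j'")
    case True
    then show ?thesis using W_mult_self_nonneg[OF z] by simp
  next
    case False
    define l where "l = (if j < m then j + 1 else j)"
    define l' where "l' = (if j' < m then j' + 1 else j')"
    have l: "j \<le> l" "l \<le> j'" "j' \<le> l'" "l' \<le> n"
      using j False m by (auto simp: l_def l'_def)
    define A where "A = {0..<j}"
    define B where "B = {j..<l}"
    define C where "C = {l..<j'}"
    define D where "D = {j'..<l'}"
    define E where "E = {l'..<n}"
    note sets = A_def B_def C_def D_def E_def
    have "sum c {l..<n} = sum c C + sum c D + sum c E"
      using l by (simp add: sets sum.atLeastLessThan_concat)
    then have s1: "step m n z c j = z * sum c A + sum c C + sum c D + sum c E"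
      by (simp add: step_def l_def A_def lessThan_atLeast0)
    have "sum c {0..<j'} = sum c A + sum c B + sum c C"
      using l by (simp add: sets sum.atLeastLessThan_concat)
    then have s2: "step m n z c j' = z * sum c A + z * sum c B + z * sum c C + sum c E"
      by (simp add: step_def l'_def E_def lessThan_atLeast0 algebra_simps)
    have AB: "\<forall>i\<in>A. \<forall>i'\<in>B. i \<le> i' \<and> i' < n"
      using l by (simp add: sets)
    have AC: "\<forall>i\<in>A. \<forall>i'\<in>C. i \<le> i' \<and> i' < n"
      using l by (simp add: sets)
    have AD: "\<forall>i\<in>A. \<forall>i'\<in>D. i \<le> i' \<and> i' < n"
      using l by (simp add: sets)
    have AE: "\<forall>i\<in>A. \<forall>i'\<in>E. i \<le> i' \<and> i' < n"
      using l by (simp add: sets)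
    have BC: "\<forall>i\<in>B. \<forall>i'\<in>C. i \<le> i' \<and> i' < n"
      using l by (simp add: sets)
    have BD: "\<forall>i\<in>B. \<forall>i'\<in>D. i \<le> i' \<and> i' < n"
      using l by (simp add: sets)
    have BE: "\<forall>i\<in>B. \<forall>i'\<in>E. i \<le> i' \<and> i' < n"
      using l by (simp add: sets)
    have CD: "\<forall>i\<in>C. \<forall>i'\<in>D. i \<le> i' \<and> i' < n"
      using l by (simp add: sets)
    have CE: "\<forall>i\<in>C. \<forall>i'\<in>E. i \<le> i' \<and> i' < n"
      using l by (simp add: sets)
    have DE: "\<forall>i\<in>D. \<forall>i'\<in>E. i \<le> i' \<and> i' < n"
      using l by (simp add: sets)
    show ?thesis
      unfolding s1 s2 by (intro conjI W_blocks_nonneg z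
        W_sums_nonneg[OF c AB] W_sums_nonneg[OF c AC] W_sums_nonneg[OF c AD]
        W_sums_nonneg[OF c AE] W_sums_nonneg[OF c BC] W_sums_nonneg[OF c BD]
        W_sums_nonneg[OF c BE] W_sums_nonneg[OF c CD] W_sums_nonneg[OF c CE]
        W_sums_nonneg[OF c DE])
  qed
qed

section \<open>Non-vanishing in a cone\<close>

text \<open>If both terms vanish, \<open>v\<close> is a real multiple of \<open>u\<close>, and the
  second term forces the factor to be 0. Hence this real-linear functional of \<open>v\<close> is
  positive on the cone spanned by \<open>u\<close> and \<open>z * u\<close>, apart from 0, and no
  nonempty sum of nonzero cone elements can vanish.\<close>

lemma cone_functional_pos:
  assumes z: "0 < Im z" and "u \<noteq> 0" "v \<noteq> 0" and nn: "W u v \<ge> 0" "W v (z * u) \<ge> 0"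
  shows "W u v + W v (z * u) > 0"
proof (rule ccontr)
  assume "\<not> ?thesis"
  with nn have 0: "W u v = 0" "W v (z * u) = 0" by linarith+
  define q where "q = v / u"
  have v: "v = q * u" using \<open>u \<noteq> 0\<close> by (simp add: q_def)
  have "Im q = 0" using 0(1) \<open>u \<noteq> 0\<close> by (simp add: v W_mult_self)
  then have q: "q = of_real (Re q)" by (simp add: complex_eq_iff)
  have "W v (z * u) = Re q * W u (z * u)"
    unfolding v by (subst q) (simp add: W_def algebra_simps)
  then have "Re q = 0" using 0(2) z \<open>u \<noteq> 0\<close> by (simp add: W_mult_self)
  with q v \<open>v \<noteq> 0\<close> show False by simp
qed

lemma cone_sum_neq_0:
  assumes z: "0 < Im z" and u: "u \<noteq> 0" and I: "finite I" "I \<noteq> {}"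
    and v: "\<And>i. i \<in> I \<Longrightarrow> v i \<noteq> 0 \<and> W u (v i) \<ge> 0 \<and> W (v i) (z * u) \<ge> 0"
  shows "sum v I \<noteq> 0"
proof
  assume "sum v I = 0"
  then have "(\<Sum>i\<in>I. W u (v i) + W (v i) (z * u)) = 0"
    by (simp add: sum.distrib W_sum_left[symmetric] W_sum_right[symmetric])
  moreover have "(\<Sum>i\<in>I. W u (v i) + W (v i) (z * u)) > 0"
    using I v cone_functional_pos[OF z u] by (intro sum_pos) auto
  ultimately show False by simp
qed

text \<open>For \<open>j < n\<close> all summands of row \<open>j\<close> lie in the cone from
  \<open>c j\<close> to \<open>z * c j\<close>: earlier entries carry the factor \<open>z\<close>,
  later ones do not. The condition on \<open>n\<close> excludes the zero row that occurs for
  \<open>n = m = 1\<close>, \<open>j = 0\<close>.\<close>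

lemma step_neq_0:
  assumes z: "0 < Im z" and c: "sector z n c" "\<And>i. i < n \<Longrightarrow> c i \<noteq> 0"
    and n: "n \<ge> 2 \<or> n = 1 \<and> m = 0" and j: "j \<le> n" and m: "m \<le> n"
  shows "step m n z c j \<noteq> 0"
proof (cases "j = n")
  case True
  then have "step m n z c j = z * (\<Sum>i<n. c i)"
    using m by (simp add: step_def)
  moreover have "(\<Sum>i<n. c i) \<noteq> 0"
    using c n by (intro cone_sum_neq_0[OF z, of "c 0"]) (auto simp: sector_def lessThan_empty_iff)
  ultimately show ?thesis using z by auto
next
  case False
  define I where "I = {..<j} \<union> {(if j < m then j + 1 else j)..<n}"
  have "step m n z c j = (\<Sum>i\<in>I. if i < j then z * c i else c i)"
    unfolding I_def step_def by (subst sum.union_disjoint) (auto simp: sum_distrib_left)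
  also have "\<dots> \<noteq> 0"
  proof (rule cone_sum_neq_0[OF z, of "c j"])
    \<comment> \<open>A column with nonzero coefficient: the first one lies left of the diagonal
      unless \<open>j = 0\<close>, and then the last one serves.\<close>
    have "(if j = 0 then n - 1 else 0) \<in> I"
      using n j False by (auto simp: I_def)
    then show "I \<noteq> {}" by blast
    fix i assume "i \<in> I"
    then have i: "i < n" using j by (auto simp: I_def)
    have sec: "i' \<le> j' \<Longrightarrow> j' < n \<Longrightarrow> W (c i') (c j') \<ge> 0 \<and> W (c j') (z * c i') \<ge> 0" for i' j'
      using c(1) by (simp add: sector_def)
    have "z \<noteq> 0" using z by auto
    then show "(if i < j then z * c i else c i) \<noteq> 0 \<and> 0 \<le> W (c j) (if i < j then z * c i else c i) \<and>
       0 \<le> W (if i < j then z * c i else c i) (z * c j)"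
      using sec[of i j] sec[of j i] j False i c(2)[OF i] by (simp add: W_mult_mult)
  qed (use c False j I_def in auto)
  finally show ?thesis .
qed

section \<open>Interlacing from the upper half plane\<close>

abbreviation cpoly :: "real poly \<Rightarrow> complex \<Rightarrow> complex" where
  "cpoly p z \<equiv> poly (map_poly complex_of_real p) z"

lemma cpoly_add: "cpoly (p + q) z = cpoly p z + cpoly q z"
proof -
  have "map_poly complex_of_real (p + q) = map_poly complex_of_real p + map_poly complex_of_real q"
    by (rule poly_eqI) (simp add: coeff_map_poly)
  then show ?thesis by simp
qed

lemma cpoly_mult: "cpoly (p * q) z = cpoly p z * cpoly q z"
proof -
  have "map_poly complex_of_real (p * q) = map_poly complex_of_real p * map_poly complex_of_real q"
    by (rule poly_eqI) (simp add: coeff_map_poly coeff_mult)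
  then show ?thesis by simp
qed

lemma cpoly_sum: "cpoly (\<Sum>i\<in>A. p i) z = (\<Sum>i\<in>A. cpoly (p i) z)"
  by (induction A rule: infinite_finite_induct) (simp_all add: cpoly_add)

lemma cpoly_linear: "cpoly [:a, 1:] z = of_real a + z"
  by (simp add: map_poly_pCons)

lemma cpoly_step: "cpoly (step m n [:0, 1:] f j) z = step m n z (\<lambda>i. cpoly (f i) z) j"
  unfolding step_def cpoly_add cpoly_mult cpoly_sum cpoly_linear by simp

lemma cpoly_cnj: "cpoly p (cnj z) = cnj (cpoly p z)"
  by (induction p) (simp_all add: map_poly_pCons)

lemma real_rootedI:
  assumes "\<And>z. 0 < Im z \<Longrightarrow> cpoly p z \<noteq> 0"
  shows "real_rooted p"
  unfolding real_rooted_def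
proof (intro disjI2 allI impI)
  fix z assume z: "cpoly p z = 0"
  then have "cpoly p (cnj z) = 0" by (simp add: cpoly_cnj)
  with z assms[of z] assms[of "cnj z"] have "Im z = 0" by fastforce
  then show "z \<in> \<real>" by (simp add: complex_is_Real_iff)
qed

text \<open>Induction on the degree: the fundamental theorem of algebra gives a complex root, which
  is real by hypothesis and can be split off over the reals.\<close>

lemma cpoly_real_rooted:
  assumes "real_rooted p" "p \<noteq> 0"
  shows "cpoly p z = of_real (lead_coeff p) * (\<Prod>\<alpha>\<in>#proots p. z - of_real \<alpha>)"
  using assms
proof (induction "degree p" arbitrary: p)
  case 0
  then obtain a where "p = [:a:]" by (metis degree_0_id)
  then show ?case using 0 by (simp add: map_poly_pCons)
next
  case (Suc n)
  have "degree (map_poly complex_of_real p) \<noteq> 0"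
    using Suc.hyps(2) by (simp add: degree_map_poly)
  then have "\<not> constant (poly (map_poly complex_of_real p))"
    by (simp add: constant_degree)
  then obtain w where w: "cpoly p w = 0"
    using fundamental_theorem_of_algebra by blast
  then obtain r where r: "w = of_real r"
    using Suc.prems by (auto simp: real_rooted_def Reals_def)
  have cr: "cpoly p (of_real x) = of_real (poly p x)" for x
    by (induction p) (simp_all add: map_poly_pCons)
  have "poly p r = 0" using w r cr by (metis of_real_eq_0_iff)
  then obtain q where q: "p = [:-r, 1:] * q"
    by (metis dvdE poly_eq_0_iff_dvd)
  have q0: "q \<noteq> 0" using Suc.prems q by auto
  have deg: "degree q = n"
    using Suc.hyps(2) q q0 by (subst (asm) q, subst (asm) degree_mult_eq) auto
  have "real_rooted q"
    using Suc.prems unfolding real_rooted_def q cpoly_mult by auto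
  then have IH: "cpoly q z = of_real (lead_coeff q) * (\<Prod>\<alpha>\<in>#proots q. z - of_real \<alpha>)"
    using Suc.hyps(1)[of q] deg q0 by simp
  have "proots p = add_mset r (proots q)"
    unfolding q using q0 by (subst proots_mult) auto
  moreover have "lead_coeff p = lead_coeff q"
    unfolding q lead_coeff_mult by simp
  moreover have "cpoly p z = (z - of_real r) * cpoly q z"
    unfolding q cpoly_mult cpoly_linear by simp
  ultimately show ?case using IH by simp
qed

section \<open>Phases and counting roots\<close>

text \<open>For \<open>y > 0\<close>, the argument of \<open>Complex t y - of_real \<alpha>\<close>
  in the open interval from 0 to \<open>pi\<close>. The sum of these phases over all roots is a
  continuous argument of the polynomial, free of jumps by \<open>2 * pi\<close>.\<close>

definition phase :: "real \<Rightarrow> real \<Rightarrow> real \<Rightarrow> real" where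
  "phase y t \<alpha> = pi / 2 - arctan ((t - \<alpha>) / y)"

lemma phase_polar:
  assumes "0 < y"
  shows "\<exists>r>0. Complex t y - of_real \<alpha> = of_real r * cis (phase y t \<alpha>)"
proof -
  define u where "u = (t - \<alpha>) / y"
  have "0 < sqrt (1 + u\<^sup>2)" by (simp add: add_pos_nonneg)
  then have "Complex t y - of_real \<alpha> = of_real (y * sqrt (1 + u\<^sup>2)) * cis (phase y t \<alpha>)"
    using assms by (simp add: complex_eq_iff phase_def cos_diff sin_diff sin_arctan cos_arctan u_def[symmetric])
       (simp add: u_def)
  with assms \<open>0 < sqrt (1 + u\<^sup>2)\<close> show ?thesis
    by (intro exI[of _ "y * sqrt (1 + u\<^sup>2)"]) simp
qed

lemma prod_mset_polar:
  assumes "0 < y"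
  shows "\<exists>r>0. (\<Prod>\<alpha>\<in>#M. Complex t y - of_real \<alpha>) = of_real r * cis (\<Sum>\<alpha>\<in>#M. phase y t \<alpha>)"
proof (induction M)
  case empty
  show ?case by (intro exI[of _ 1]) simp
next
  case (add \<alpha> M)
  then obtain r where r: "r > 0" "(\<Prod>\<alpha>\<in>#M. Complex t y - of_real \<alpha>) = of_real r * cis (\<Sum>\<alpha>\<in>#M. phase y t \<alpha>)"
    by blast
  obtain s where s: "s > 0" "Complex t y - of_real \<alpha> = of_real s * cis (phase y t \<alpha>)"
    using phase_polar[OF assms] by blast
  show ?case
    using r s by (intro exI[of _ "s * r"]) (simp add: cis_mult[symmetric])
qed

lemma continuous_on_sum_mset_phase:
  "0 < y \<Longrightarrow> continuous_on UNIV (\<lambda>t. \<Sum>\<alpha>\<in>#M. phase y t \<alpha>)"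
  by (induction M) (auto simp: phase_def intro!: continuous_intros)

lemma sum_mset_phase_at_top:
  assumes "0 < y"
  shows "((\<lambda>t. \<Sum>\<alpha>\<in>#M. phase y t \<alpha>) \<longlongrightarrow> 0) at_top"
proof (induction M)
  case (add \<alpha> M)
  have "((\<lambda>t. phase y t \<alpha>) \<longlongrightarrow> 0) at_top"
    unfolding phase_def using assms by real_asymp
  from tendsto_add[OF this add.IH] show ?case by simp
qed simp

definition roots_above :: "real poly \<Rightarrow> real \<Rightarrow> nat" where
  "roots_above p t = size {#\<alpha> \<in># proots p. \<alpha> > t#}"

text \<open>Approaching \<open>t\<close> along a parabola tangent to the real axis counts a root at \<open>t\<close> itself as lying to the left.\<close>

lemma sum_mset_phase_at_right:
  "((\<lambda>s. \<Sum>\<alpha>\<in>#M. phase (s\<^sup>2) (t + s) \<alpha>) \<longlongrightarrow> pi * size {#\<alpha> \<in># M. \<alpha> > t#}) (at_right 0)"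
proof (induction M)
  case (add \<alpha> M)
  have "((\<lambda>s. phase (s\<^sup>2) (t + s) \<alpha>) \<longlongrightarrow> (if \<alpha> > t then pi else 0)) (at_right 0)"
  proof -
    consider "\<alpha> > t" | "\<alpha> = t" | "\<alpha> < t" by linarith
    then show ?thesis
    proof cases
      case 1
      define d where "d = \<alpha> - t"
      have d: "d > 0" "\<alpha> = t + d" using 1 by (auto simp: d_def)
      have "((\<lambda>s. pi / 2 - arctan ((s - d) / s\<^sup>2)) \<longlongrightarrow> pi) (at_right 0)"
        using \<open>d > 0\<close> by real_asymp
      with d show ?thesis by (simp add: phase_def)
    next
      case 2
      have "((\<lambda>s::real. pi / 2 - arctan (s / s\<^sup>2)) \<longlongrightarrow> 0) (at_right 0)"
        by real_asymp
      with 2 show ?thesis by (simp add: phase_def)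
    next
      case 3
      define d where "d = t - \<alpha>"
      have d: "d > 0" "\<alpha> = t - d" using 3 by (auto simp: d_def)
      have "((\<lambda>s. pi / 2 - arctan ((s + d) / s\<^sup>2)) \<longlongrightarrow> 0) (at_right 0)"
        using \<open>d > 0\<close> by real_asymp
      with d show ?thesis by (simp add: phase_def add.commute)
    qed
  qed
  from tendsto_add[OF this add.IH] show ?case by (auto simp: algebra_simps)
qed simp

text \<open>The phase difference tends to \<open>0\<close> at the right end of a horizontal line, and its sine is never
  negative, so by the intermediate value theorem it is trapped in \<open>[0, \<pi>]\<close>.\<close>

lemma phase_difference_bounds:
  assumes f: "real_rooted f" "lead_coeff f > 0" and g: "real_rooted g" "lead_coeff g > 0"
    and W: "\<And>z. 0 < Im z \<Longrightarrow> W (cpoly f z) (cpoly g z) \<ge> 0"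
    and y: "0 < y"
  shows "(\<Sum>\<alpha>\<in>#proots g. phase y t \<alpha>) - (\<Sum>\<alpha>\<in>#proots f. phase y t \<alpha>) \<in> {0..pi}"
proof -
  define h where "h t = (\<Sum>\<alpha>\<in>#proots g. phase y t \<alpha>) - (\<Sum>\<alpha>\<in>#proots f. phase y t \<alpha>)" for t
  have polar: "\<exists>r>0. cpoly p (Complex t y) = of_real r * cis (\<Sum>\<alpha>\<in>#proots p. phase y t \<alpha>)"
    if p: "real_rooted p" "lead_coeff p > 0" for p t
  proof -
    obtain r where r: "r > 0" "(\<Prod>\<alpha>\<in>#proots p. Complex t y - of_real \<alpha>) =
        of_real r * cis (\<Sum>\<alpha>\<in>#proots p. phase y t \<alpha>)"
      using prod_mset_polar[OF y] by blast
    have "p \<noteq> 0" using p by auto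
    then show ?thesis
      using r p by (intro exI[of _ "lead_coeff p * r"]) (simp add: cpoly_real_rooted)
  qed
  have sin: "sin (h t) \<ge> 0" for t
  proof -
    obtain r where r: "r > 0" "cpoly f (Complex t y) = of_real r * cis (\<Sum>\<alpha>\<in>#proots f. phase y t \<alpha>)"
      using polar[OF f] by blast
    obtain s where s: "s > 0" "cpoly g (Complex t y) = of_real s * cis (\<Sum>\<alpha>\<in>#proots g. phase y t \<alpha>)"
      using polar[OF g] by blast
    have "W (cpoly f (Complex t y)) (cpoly g (Complex t y)) = r * s * sin (h t)"
      unfolding r s h_def W_def sin_diff by (simp add: algebra_simps)
    with W[of "Complex t y"] y have "0 \<le> r * s * sin (h t)" by simp
    with mult_pos_pos[OF r(1) s(1)] show ?thesis
      using zero_le_mult_iff[of "r * s" "sin (h t)"] by linarith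
  qed
  have cont: "continuous_on UNIV h"
    unfolding h_def using y by (intro continuous_intros continuous_on_sum_mset_phase)
  have lim: "(h \<longlongrightarrow> 0) at_top"
    unfolding h_def using tendsto_diff[OF sum_mset_phase_at_top[OF y] sum_mset_phase_at_top[OF y]] by simp
  have "h t \<ge> 0"
  proof (rule ccontr)
    assume "\<not> h t \<ge> 0"
    \<comment> \<open>A level between \<open>h t\<close> and the limit 0, cut off at
      \<open>- pi / 2\<close> so that its sine is negative.\<close>
    define v where "v = max (h t) (- pi / 2)"
    have v: "v < 0" "h t \<le> v" "- pi / 2 \<le> v"
      using \<open>\<not> h t \<ge> 0\<close> by (auto simp: v_def)
    have ev: "eventually (\<lambda>s. h s > v) at_top" by (rule order_tendstoD(1)[OF lim v(1)])
    obtain s where s: "s > t" "h s > v"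
      using eventually_happens'[OF trivial_limit_at_top_linorder eventually_conj[OF eventually_gt_at_top[of t] ev]]
      by blast
    have "\<exists>x\<ge>t. x \<le> s \<and> h x = v"
      using s v by (intro IVT') (auto intro: continuous_on_subset[OF cont])
    then obtain x where "h x = v" by blast
    moreover have "sin v < 0"
      using sin_gt_zero[of "- v"] v pi_gt_zero by auto
    ultimately show False using sin[of x] by simp
  qed
  moreover have "h t \<le> pi"
  proof (rule ccontr)
    assume "\<not> h t \<le> pi"
    \<comment> \<open>Likewise a level above \<open>pi\<close>, cut off at
      \<open>3 * pi / 2\<close>, where the sine is negative.\<close>
    define v where "v = min (h t) (3 * pi / 2)"
    have v: "pi < v" "v \<le> h t" "v \<le> 3 * pi / 2"
      using \<open>\<not> h t \<le> pi\<close> pi_gt_zero by (auto simp: v_def)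
    have "0 < v" using v pi_gt_zero by linarith
    have ev: "eventually (\<lambda>s. h s < v) at_top" by (rule order_tendstoD(2)[OF lim \<open>0 < v\<close>])
    obtain s where s: "s > t" "h s < v"
      using eventually_happens'[OF trivial_limit_at_top_linorder eventually_conj[OF eventually_gt_at_top[of t] ev]]
      by blast
    have "\<exists>x\<ge>t. x \<le> s \<and> h x = v"
      using s v by (intro IVT2') (auto intro: continuous_on_subset[OF cont])
    then obtain x where "h x = v" by blast
    moreover have "sin v < 0" using v pi_gt_zero by (intro sin_lt_zero) linarith+
    ultimately show False using sin[of x] by simp
  qed
  ultimately show ?thesis by (simp add: h_def)
qed

text \<open>Along the parabola the phase difference stays in the closed interval from 0 to
  \<open>pi\<close> and tends to \<open>pi\<close> times the difference of the root counts.\<close>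

lemma roots_above_bounds:
  assumes f: "real_rooted f" "lead_coeff f > 0" and g: "real_rooted g" "lead_coeff g > 0"
    and W: "\<And>z. 0 < Im z \<Longrightarrow> W (cpoly f z) (cpoly g z) \<ge> 0"
  shows "roots_above f t \<le> roots_above g t" "roots_above g t \<le> roots_above f t + 1"
proof -
  let ?h = "\<lambda>s. (\<Sum>\<alpha>\<in>#proots g. phase (s\<^sup>2) (t + s) \<alpha>) - (\<Sum>\<alpha>\<in>#proots f. phase (s\<^sup>2) (t + s) \<alpha>)"
  have lim: "(?h \<longlongrightarrow> pi * roots_above g t - pi * roots_above f t) (at_right 0)"
    unfolding roots_above_def by (intro tendsto_diff sum_mset_phase_at_right)
  have ev: "eventually (\<lambda>s. ?h s \<in> {0..pi}) (at_right 0)"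
    using eventually_at_right_less[of 0]
    by eventually_elim (rule phase_difference_bounds[OF assms], auto)
  have "pi * roots_above g t - pi * roots_above f t \<in> {0..pi}"
    by (rule Lim_in_closed_set[OF _ ev _ lim]) auto
  then have "pi * roots_above f t \<le> pi * roots_above g t" "pi * roots_above g t \<le> pi * real (roots_above f t + 1)"
    by (auto simp: algebra_simps)
  then show "roots_above f t \<le> roots_above g t" "roots_above g t \<le> roots_above f t + 1"
    by (simp_all only: mult_le_cancel_left_pos[OF pi_gt_zero] of_nat_le_iff)
qed

section \<open>From root counts to interlacing\<close>

lemma sorted_desc_nth_gt_iff:
  fixes xs :: "'a :: linorder list"
  assumes "sorted_wrt (\<ge>) xs"
  shows "i < length (filter (\<lambda>a. a > t) xs) \<longleftrightarrow> i < length xs \<and> xs ! i > t"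
  using assms
proof (induction xs arbitrary: i)
  case (Cons x xs)
  show ?case
  proof (cases "x > t")
    case True
    then show ?thesis using Cons by (cases i) auto
  next
    case False
    then have "filter (\<lambda>a. a > t) (x # xs) = []" "\<forall>y\<in>set (x # xs). \<not> y > t"
      using Cons.prems by (auto simp: filter_empty_conv)
    then show ?thesis by (metis length_0_conv less_nat_zero_code nth_mem)
  qed
qed simp

lemma less_roots_above_iff:
  "i < roots_above p t \<longleftrightarrow> i < length (roots_desc p) \<and> roots_desc p ! i > t"
proof -
  have "mset (roots_desc p) = proots p" by (simp add: roots_desc_def)
  then have "roots_above p t = length (filter (\<lambda>a. a > t) (roots_desc p))"
    unfolding roots_above_def by (metis mset_filter size_mset)
  moreover have "sorted_wrt (\<ge>) (roots_desc p)"
    unfolding roots_desc_def by (simp add: sorted_wrt_rev sorted_sorted_list_of_multiset)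
  ultimately show ?thesis using sorted_desc_nth_gt_iff by simp
qed

text \<open>The count above \<open>t\<close> exceeds \<open>i\<close> iff the root with index
  \<open>i\<close> exists and is above \<open>t\<close>. Taking \<open>t\<close> to be the other
  root in question gives the inequalities of the chain, and taking \<open>t\<close> below a suitable
  root compares the numbers of roots.\<close>

lemma interlacesI_roots_above:
  assumes "real_rooted f" "real_rooted g"
    and le: "\<And>t. roots_above f t \<le> roots_above g t" and ge: "\<And>t. roots_above g t \<le> roots_above f t + 1"
  shows "f \<preceq> g"
proof -
  let ?a = "roots_desc f" and ?b = "roots_desc g"
  have lower: "i < length ?b \<and> ?b ! i > t" if "i < length ?a" "?a ! i > t" for i t
    using that le[of t] less_roots_above_iff[of i f t] less_roots_above_iff[of i g t] by linarith
  have upper: "i < length ?a \<and> ?a ! i > t" if "i + 1 < length ?b" "?b ! (i + 1) > t" for i t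
    using that ge[of t] less_roots_above_iff[of i f t] less_roots_above_iff[of "i + 1" g t] by linarith
  have "length ?a \<le> length ?b"
  proof (cases "length ?a")
    case (Suc m)
    obtain t where "t < ?a ! m" using lt_ex by blast
    then show ?thesis using lower[of m t] Suc by simp
  qed simp
  moreover have "length ?b \<le> length ?a + 1"
  proof (rule ccontr)
    assume "\<not> ?thesis"
    then have "length ?a + 1 < length ?b" by simp
    moreover obtain t where "t < ?b ! (length ?a + 1)" using lt_ex by blast
    ultimately show False using upper[of "length ?a" t] by simp
  qed
  moreover have "?a ! i \<le> ?b ! i" if "i < length ?a" for i
    using lower[OF that, of "?b ! i"] by (cases "?a ! i \<le> ?b ! i") auto
  moreover have "?b ! (i + 1) \<le> ?a ! i" if "i + 1 < length ?b" for i
    using upper[OF that, of "?a ! i"] by (cases "?b ! (i + 1) \<le> ?a ! i") auto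
  ultimately have "(length ?b = length ?a \<or> length ?b = length ?a + 1) \<and>
      (\<forall>i < length ?a. ?a ! i \<le> ?b ! i) \<and> (\<forall>i. i + 1 < length ?b \<longrightarrow> ?b ! (i + 1) \<le> ?a ! i)"
    by auto
  then show ?thesis
    using assms(1,2) unfolding interlaces_def Let_def by blast
qed

section \<open>Interlacing of the excedance polynomials\<close>

lemma sector_cong: "(\<And>i. i < n \<Longrightarrow> c i = c' i) \<Longrightarrow> sector z n c \<longleftrightarrow> sector z n c'"
  unfolding sector_def by auto

lemma sector_dpoly:
  assumes z: "0 < Im z" and "k \<le> n"
  shows "sector z (n + 1) (\<lambda>j. cpoly (dpoly n k j) z)"
  using assms(2)
proof (induction n arbitrary: k)
  case 0
  then show ?case using z by (simp add: dpoly_def sector_def W_def)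
next
  case (Suc n)
  show ?case
  proof (cases k)
    case 0
    have "sector z (n + 1 + 1) (step 0 (n + 1) z (\<lambda>i. cpoly (dpoly n 0 i) z))"
      by (rule sector_step[OF z Suc.IH]) auto
    then show ?thesis
      by (subst sector_cong[where c' = "step 0 (n + 1) z (\<lambda>i. cpoly (dpoly n 0 i) z)"])
        (use dpoly_0_step[of _ n] in \<open>auto simp: 0 cpoly_step[symmetric]\<close>)
  next
    case (Suc l)
    then have "sector z (n + 1 + 1) (step (n + 1 - l) (n + 1) z (\<lambda>i. cpoly (dpoly n l i) z))"
      using Suc.prems by (intro sector_step[OF z Suc.IH]) auto
    then show ?thesis
      by (subst sector_cong[where c' = "step (n + 1 - l) (n + 1) z (\<lambda>i. cpoly (dpoly n l i) z)"])
        (use dpoly_Suc_step[of l n] Suc.prems in \<open>auto simp: \<open>k = Suc l\<close> cpoly_step[symmetric]\<close>)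
  qed
qed

text \<open>The exceptional pair: a permutation of two letters with value 1 in place 1 also fixes 2,
  so the first entry is zero.\<close>

lemma dpoly_1_1: "dpoly 1 1 0 = 0" "dpoly 1 1 1 = [:0, 1:]"
  using dpoly_Suc_step[of 0 0 0] dpoly_Suc_step[of 0 0 1] by (simp_all add: step_def dpoly_def[of 0])

text \<open>\<open>step_neq_0\<close> needs a predecessor row without zeros. Only the row for
  \<open>(2, 2)\<close> descends from the exceptional row \<open>(0, x)\<close>; it is computed
  directly as \<open>(x, x, x^2)\<close>.\<close>

lemma cpoly_dpoly_neq_0:
  assumes z: "0 < Im z" and "k \<le> n" "j \<le> n" "(n, k) \<noteq> (1, 1)"
  shows "cpoly (dpoly n k j) z \<noteq> 0"
  using assms(2-)
proof (induction n arbitrary: k j)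
  case 0
  then show ?case by (simp add: dpoly_def)
next
  case (Suc n)
  consider "k = 0" | "n = 1" "k = 2" | l where "k = Suc l" "(n, l) \<noteq> (1, 1)" "n \<ge> 1"
    using Suc.prems by (cases k; cases n) auto
  then show ?case
  proof cases
    case 1
    then show ?thesis
      using Suc step_neq_0[OF z sector_dpoly[OF z, of 0 n], of 0 j] dpoly_0_step[of j n]
      by (cases "n = 0") (simp_all add: cpoly_step)
  next
    case 2
    have "dpoly 2 2 j = step 1 2 [:0, 1:] (dpoly 1 1) j"
      using dpoly_Suc_step[of 1 1 j] Suc.prems 2 by (simp add: numeral_2_eq_2)
    moreover have "j = 0 \<or> j = 1 \<or> j = 2" using Suc.prems 2 by auto
    ultimately have "dpoly 2 2 j = [:0, 1:] \<or> dpoly 2 2 j = [:0, 1:] * [:0, 1:]"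
      using dpoly_1_1 by (auto simp: step_def numeral_2_eq_2)
    then show ?thesis
      using 2 z by (auto simp: cpoly_mult cpoly_linear numeral_2_eq_2 simp del: mult_pCons_left mult_pCons_right)
  next
    case 3
    then show ?thesis
      using Suc step_neq_0[OF z sector_dpoly[OF z, of l n], of "n + 1 - l" j] dpoly_Suc_step[of l n j]
      by (simp add: cpoly_step)
  qed
qed

lemma lead_coeff_dpoly_pos:
  assumes "dpoly n k j \<noteq> 0"
  shows "lead_coeff (dpoly n k j) > 0"
proof -
  have "coeff (dpoly n k j) i \<ge> 0" for i
    by (auto simp: dpoly_def coeff_sum intro!: sum_nonneg)
  then show ?thesis using assms by (metis leading_coeff_0_iff order_le_less)
qed

lemma dpoly_real_rooted:
  assumes "k \<le> n" "j \<le> n" "(n, k) \<noteq> (1, 1)"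
  shows "real_rooted (dpoly n k j)" "lead_coeff (dpoly n k j) > 0"
proof -
  show "real_rooted (dpoly n k j)"
    using cpoly_dpoly_neq_0[OF _ assms] by (rule real_rootedI)
  have "cpoly (dpoly n k j) \<i> \<noteq> 0"
    using cpoly_dpoly_neq_0[OF _ assms] by simp
  then show "lead_coeff (dpoly n k j) > 0"
    by (intro lead_coeff_dpoly_pos) auto
qed

lemma roots_above_dpoly_mono:
  assumes "k \<le> n" "(n, k) \<noteq> (1, 1)" "i \<le> j" "j \<le> n"
  shows "roots_above (dpoly n k i) t \<le> roots_above (dpoly n k j) t"
    and "roots_above (dpoly n k j) t \<le> roots_above (dpoly n k i) t + 1"
proof -
  have "W (cpoly (dpoly n k i) z) (cpoly (dpoly n k j) z) \<ge> 0" if "0 < Im z" for z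
    using sector_dpoly[OF that assms(1)] assms unfolding sector_def by simp
  then show "roots_above (dpoly n k i) t \<le> roots_above (dpoly n k j) t"
    "roots_above (dpoly n k j) t \<le> roots_above (dpoly n k i) t + 1"
    using assms by (intro roots_above_bounds dpoly_real_rooted; simp)+
qed

lemma dpoly_interlaces:
  assumes "k \<le> n" "(n, k) \<noteq> (1, 1)" "i \<le> j" "j \<le> n"
  shows "dpoly n k i \<preceq> dpoly n k j"
  using assms by (intro interlacesI_roots_above dpoly_real_rooted roots_above_dpoly_mono) auto

section \<open>Comparison with the Eulerian polynomial\<close>

text \<open>With \<open>n = m + 1\<close>, \<open>dpoly n (k + 1) 0\<close> is the sum of the
  entries of \<open>dpoly m k\<close> from index 1 on, and \<open>dpoly n k 0\<close> also includes
  entry 0, which has the smallest argument in the sector. So passing from \<open>k\<close> to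
  \<open>k + 1\<close> can only increase the argument.\<close>

lemma roots_above_eulerian_le:
  assumes "k \<le> n" "n \<ge> 2"
  shows "roots_above (dpoly n 0 0) t \<le> roots_above (dpoly n k 0) t"
  using assms(1)
proof (induction k)
  case (Suc k)
  obtain m where n: "n = m + 1" using assms(2) by (cases n) auto
  have k: "k \<le> m" using Suc.prems n by simp
  have "W (cpoly (dpoly n k 0) z) (cpoly (dpoly n (k + 1) 0) z) \<ge> 0" if z: "0 < Im z" for z
  proof -
    define c where "c i = cpoly (dpoly m k i) z" for i
    have "dpoly n k 0 = dpoly n (k + 1) 0 + dpoly m k 0"
      using dpoly_Suc_k[of k m 0] k n by simp
    then have 1: "cpoly (dpoly n k 0) z = cpoly (dpoly n (k + 1) 0) z + c 0"
      by (simp add: cpoly_add c_def)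
    have 2: "cpoly (dpoly n (k + 1) 0) z = sum c {1..<m + 1}"
      using dpoly_Suc_step[of k m 0] k n by (simp add: step_def cpoly_sum cpoly_add c_def)
    have "sector z (m + 1) c"
      using sector_dpoly[OF z k] by (simp add: c_def[abs_def])
    from W_sums_nonneg(1)[OF this, of "{0}" "{1..<m + 1}"]
    show ?thesis unfolding 1 unfolding 2 W_add_left by simp
  qed
  then have "roots_above (dpoly n k 0) t \<le> roots_above (dpoly n (k + 1) 0) t"
    using Suc.prems assms(2) by (intro roots_above_bounds dpoly_real_rooted) auto
  then show ?case using Suc by simp
qed simp

text \<open>A move to the right within row \<open>k + 1\<close> alternates with the equality
  \<open>dpoly n (k + 1) (n - k) = dpoly n k (n - k)\<close>: the only additional fixed point
  allowed for \<open>k\<close> would be \<open>n - k + 1\<close>, but that place holds the value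
  1.\<close>

lemma roots_above_le_eulerian:
  assumes "k \<le> n" "n \<ge> 2"
  shows "roots_above (dpoly n k (n - k)) t \<le> roots_above (dpoly n 0 n) t"
  using assms(1)
proof (induction k)
  case (Suc k)
  obtain m where n: "n = m + 1" using assms(2) by (cases n) auto
  have "roots_above (dpoly n (Suc k) (n - Suc k)) t \<le> roots_above (dpoly n (Suc k) (n - k)) t"
    using Suc.prems assms(2) by (intro roots_above_dpoly_mono) auto
  also have "dpoly n (Suc k) (n - k) = dpoly n k (n - k)"
    using dpoly_Suc_k[of k m "n - k"] Suc.prems n by simp
  also have "roots_above \<dots> t \<le> roots_above (dpoly n 0 n) t"
    using Suc by simp
  finally show ?case .
qed simp

lemma eulerian_interlaces_dpoly:
  assumes "k \<le> n" "n \<ge> 2" "j \<le> n - k"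
  shows "eulerian_poly n \<preceq> dpoly n k j"
  unfolding eulerian_poly_eq_dpoly
proof (rule interlacesI_roots_above)
  show "real_rooted (dpoly n 0 0)" "real_rooted (dpoly n k j)"
    using assms by (simp_all add: dpoly_real_rooted(1))
  fix t
  have "roots_above (dpoly n 0 0) t \<le> roots_above (dpoly n k 0) t"
    using assms by (intro roots_above_eulerian_le)
  also have "\<dots> \<le> roots_above (dpoly n k j) t"
    using assms by (intro roots_above_dpoly_mono) auto
  finally show "roots_above (dpoly n 0 0) t \<le> roots_above (dpoly n k j) t" .
  have "roots_above (dpoly n k j) t \<le> roots_above (dpoly n k (n - k)) t"
    using assms by (intro roots_above_dpoly_mono) auto
  also have "\<dots> \<le> roots_above (dpoly n 0 n) t"
    using assms by (intro roots_above_le_eulerian)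
  \<comment> \<open>Both ends of the chain lie in the row for \<open>k = 0\<close>, which bounds the
    total increase by one.\<close>
  also have "\<dots> \<le> roots_above (dpoly n 0 0) t + 1"
    using assms by (intro roots_above_dpoly_mono) auto
  finally show "roots_above (dpoly n k j) t \<le> roots_above (dpoly n 0 0) t + 1" .
qed

theorem theorem4p4:
  fixes n k :: nat
  assumes "k \<le> n"
  shows "(\<forall>j \<le> n. real_rooted (dpoly n k j))
       \<and> interlacing_seq n (\<lambda>j. dpoly n k j)
       \<and> (\<forall>j \<in> {0..n - k}. eulerian_poly n \<preceq> dpoly n k j)"
proof (cases "(n, k) = (1, 1)")
  case True
  \<comment> \<open>Here the sequence is \<open>(0, x)\<close>; its interlacing relations hold by
    the convention for the zero polynomial.\<close>
  have 0: "real_rooted 0" by (simp add: real_rooted_def)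
  have X: "real_rooted [:0, 1:]"
    by (rule real_rootedI) (auto simp: cpoly_linear)
  have A: "real_rooted (eulerian_poly 1)"
    unfolding eulerian_poly_eq_dpoly by (rule dpoly_real_rooted) auto
  have "real_rooted (dpoly 1 1 j)" if "j \<le> 1" for j
  proof -
    have "j = 0 \<or> j = 1" using that by linarith
    then show ?thesis using 0 X dpoly_1_1 by metis
  qed
  moreover have "dpoly 1 1 i \<preceq> dpoly 1 1 j" if "i < j" "j \<le> 1" for i j
  proof -
    have "i = 0" "j = 1" using that by linarith+
    then show ?thesis using 0 X dpoly_1_1 by (simp add: interlaces_def)
  qed
  moreover have "eulerian_poly 1 \<preceq> dpoly 1 1 0"
    using 0 A dpoly_1_1 by (simp add: interlaces_def)
  ultimately show ?thesis
    using True by (simp add: interlacing_seq_def)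
next
  case False
  have "eulerian_poly n \<preceq> dpoly n k j" if "j \<le> n - k" for j
  proof (cases "n \<ge> 2")
    case True
    then show ?thesis using assms that by (rule_tac eulerian_interlaces_dpoly)
  next
    \<comment> \<open>For \<open>n \<le> 1\<close> only \<open>k = 0\<close> remains, and the
      Eulerian polynomial is then the first entry of the row itself.\<close>
    case False
    with \<open>(n, k) \<noteq> (1, 1)\<close> assms have "k = 0" by (cases n) auto
    then show ?thesis
      unfolding eulerian_poly_eq_dpoly using that by (simp add: dpoly_interlaces)
  qed
  then show ?thesis
    using assms False by (auto simp: interlacing_seq_def dpoly_real_rooted dpoly_interlaces)
qed

end
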